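(* Let $n \geq 2$ and let $G_1,\ldots,G_n$ be vertex-disjoint graphs with $u_iv_i \in E(G_i)$ for each $i \in [n]$. Let $G$ be the graph obtained from the disjoint union of $G_1,\ldots,G_n$ by identifying $u_1,\ldots,u_n$ as a single vertex $u$ and $v_1,\ldots,v_n$ as a single vertex $v$. Then for every integer $m \geq 2$, $$P_{DP}(G,m) \leq \frac{\prod_{i=1}^{n} P_{DP}(G_i,m)}{(m(m-1))^{n-1}}.$$
   Context: All graphs are finite and simple; $[m]=\{1,\ldots,m\}$. A cover of a graph $G$ is a pair $\mathcal{H}=(L,H)$ where $H$ is a graph and $L:V(G)\to\mathcal{P}(V(H))$ satisfies: (1) $\{L(u):u\in V(G)\}$ is a partition of $V(H)$ into $|V(G)|$ parts; (2) $H[L(u)]$ is complete for each $u$; (3) if $E_H(L(u),L(v))$ is nonempty then $u=v$ or $uv\in E(G)$; (4) if $uv\in E(G)$ then $E_H(L(u),L(v))$ is a (possibly empty) matching. $\mathcal{H}$ is $m$-fold if $|L(u)|=m$ for all $u$. An $\mathcal{H}$-coloring of $G$ is an independent set of $H$ of size $|V(G)|$. $P_{DP}(G,\mathcal{H})$ is the number of $\mathcal{H}$-colorings, and the DP color function $P_{DP}(G,m)$ is the minimum of $P_{DP}(G,\mathcal{H})$ over all $m$-fold covers $\mathcal{H}$ of $G$. *)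

theory Defs
  imports Complex_Main "HOL-Library.Disjoint_Sets" "Graph_Theory.Kuratowski"
begin

text \<open>
  Finite simple graphs are rendered by the locale \<^locale>\<open>pair_graph\<close>: an undirected edge
  \<open>xy\<close> is the pair of arcs \<open>(x, y)\<close>, \<open>(y, x)\<close>.
\<close>

definition edges_between :: "'h pair_pre_digraph \<Rightarrow> 'h set \<Rightarrow> 'h set \<Rightarrow> 'h set set" where
  "edges_between H A B = {{x, y} | x y. x \<in> A \<and> y \<in> B \<and> (x, y) \<in> parcs H}"

definition matching :: "'h set set \<Rightarrow> bool" where
  "matching M \<longleftrightarrow> disjoint M"

definition independent_set :: "'h pair_pre_digraph \<Rightarrow> 'h set \<Rightarrow> bool" where
  "independent_set H S \<longleftrightarrow> S \<subseteq> pverts H \<and> (\<forall>x\<in>S. \<forall>y\<in>S. (x, y) \<notin> parcs H)"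

definition dp_cover ::
  "'a pair_pre_digraph \<Rightarrow> ('a \<Rightarrow> 'h set) \<Rightarrow> 'h pair_pre_digraph \<Rightarrow> bool" where
  "dp_cover G L H \<longleftrightarrow>
     pair_graph H \<and>
     partition_on (pverts H) (L ` pverts G) \<and> card (L ` pverts G) = card (pverts G) \<and>
     (\<forall>u\<in>pverts G. complete_digraph (card (L u)) (with_proj H \<restriction> L u)) \<and>
     (\<forall>u\<in>pverts G. \<forall>v\<in>pverts G.
        edges_between H (L u) (L v) \<noteq> {} \<longrightarrow> u = v \<or> (u, v) \<in> parcs G) \<and>
     (\<forall>u\<in>pverts G. \<forall>v\<in>pverts G.
        (u, v) \<in> parcs G \<longrightarrow> matching (edges_between H (L u) (L v)))"

definition fold_cover ::
  "nat \<Rightarrow> 'a pair_pre_digraph \<Rightarrow> ('a \<Rightarrow> 'h set) \<Rightarrow> 'h pair_pre_digraph \<Rightarrow> bool" where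
  "fold_cover m G L H \<longleftrightarrow> dp_cover G L H \<and> (\<forall>u\<in>pverts G. card (L u) = m)"

definition dp_colorings :: "'a pair_pre_digraph \<Rightarrow> 'h pair_pre_digraph \<Rightarrow> 'h set set" where
  "dp_colorings G H = {S. independent_set H S \<and> card S = card (pverts G)}"

text \<open>
  The minimum ranges over covers whose cover graph has vertices in \<^typ>\<open>nat\<close>. This is no
  restriction, as cover graphs are finite: see \<open>dp_color_function_le\<close> (every \<open>m\<close>-fold cover, over
  any vertex type, is accounted for) and \<open>dp_color_function_attained\<close> below.
\<close>

definition dp_color_function :: "'a pair_pre_digraph \<Rightarrow> nat \<Rightarrow> nat" where
  "dp_color_function G m =
     (LEAST k. \<exists>L (H :: nat pair_pre_digraph). fold_cover m G L H \<and> k = card (dp_colorings G H))"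

definition graph_Union :: "'i set \<Rightarrow> ('i \<Rightarrow> 'a pair_pre_digraph) \<Rightarrow> 'a pair_pre_digraph" where
  "graph_Union I G = \<lparr>pverts = (\<Union>i\<in>I. pverts (G i)), parcs = (\<Union>i\<in>I. parcs (G i))\<rparr>"

definition quotient_graph :: "'a pair_pre_digraph \<Rightarrow> 'a rel \<Rightarrow> 'a set pair_pre_digraph" where
  "quotient_graph G r =
     \<lparr>pverts = pverts G // r, parcs = (\<lambda>(x, y). (r `` {x}, r `` {y})) ` parcs G\<rparr>"

definition identify_rel :: "'a set \<Rightarrow> 'a set \<Rightarrow> 'a set \<Rightarrow> 'a rel" where
  "identify_rel V A B = Id_on V \<union> A \<times> A \<union> B \<times> B"

definition edge_gluing ::
  "'i set \<Rightarrow> ('i \<Rightarrow> 'a pair_pre_digraph) \<Rightarrow> ('i \<Rightarrow> 'a) \<Rightarrow> ('i \<Rightarrow> 'a) \<Rightarrow> 'a set pair_pre_digraph" where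
  "edge_gluing I G u v =
     quotient_graph (graph_Union I G) (identify_rel (pverts (graph_Union I G)) (u ` I) (v ` I))"


lemma pair_graph_iff:
  "pair_graph G \<longleftrightarrow> finite (pverts G) \<and> parcs G \<subseteq> pverts G \<times> pverts G \<and> sym (parcs G) \<and>
     (\<forall>x. (x, x) \<notin> parcs G)" (is "_ \<longleftrightarrow> ?R")
proof
  assume "pair_graph G"
  then interpret pair_graph G .
  show ?R
    using pair_finite_verts arc_fst_in_verts arc_snd_in_verts pair_no_loops arcs_symmetric
    by (fastforce simp: sym_def)
next
  assume R: ?R
  then have "finite (parcs G)" by (meson finite_SigmaI finite_subset)
  with R show "pair_graph G"
    by unfold_locales (auto simp: symmetric_def)
qed

lemma complete_induced_iff:
  assumes "pair_graph H" "A \<subseteq> pverts H"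
  shows "complete_digraph (card A) (with_proj H \<restriction> A) \<longleftrightarrow>
    (\<forall>x\<in>A. \<forall>y\<in>A. x \<noteq> y \<longrightarrow> (x, y) \<in> parcs H)"
proof -
  define K where "K = \<lparr>pverts = A, parcs = {(x, y) \<in> parcs H. x \<in> A \<and> y \<in> A}\<rparr>"
  have *: "with_proj H \<restriction> A = with_proj K"
    by (auto simp: induce_subgraph_def with_proj_def K_def)
  have "finite A" "\<And>x. (x, x) \<notin> parcs H"
    using assms by (auto simp: pair_graph_iff intro: finite_subset)
  then show ?thesis
    unfolding * complete_digraph_pair_def by (auto simp: K_def)
qed

lemma dp_cover_partD:
  assumes "dp_cover G L H" "u \<in> pverts G"
  shows "L u \<subseteq> pverts H"
  using assms by (auto simp: dp_cover_def partition_on_def)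

text \<open>Every cover is isomorphic to one over \<^typ>\<open>nat\<close>.\<close>

lemma fold_cover_nat:
  fixes H :: "'h pair_pre_digraph"
  assumes "fold_cover m G L H"
  obtains L' and H' :: "nat pair_pre_digraph" where
    "fold_cover m G L' H'" "card (dp_colorings G H') = card (dp_colorings G H)"
proof -
  have c: "dp_cover G L H" and m: "\<And>u. u \<in> pverts G \<Longrightarrow> card (L u) = m"
    using assms by (auto simp: fold_cover_def)
  have pg: "pair_graph H" using c by (simp add: dp_cover_def)
  then have fin: "finite (pverts H)" and sub: "parcs H \<subseteq> pverts H \<times> pverts H"
    and sy: "sym (parcs H)" and irr: "\<And>x. (x, x) \<notin> parcs H"
    by (auto simp: pair_graph_iff)
  obtain f :: "'h \<Rightarrow> nat" where inj: "inj_on f (pverts H)"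
    using finite_imp_inj_to_nat_seg[OF fin] by blast
  define H' where "H' = \<lparr>pverts = f ` pverts H, parcs = map_prod f f ` parcs H\<rparr>"
  define L' where "L' u = f ` L u" for u
  have arc: "(f x, f y) \<in> parcs H' \<longleftrightarrow> (x, y) \<in> parcs H"
    if "x \<in> pverts H" "y \<in> pverts H" for x y
  proof
    assume "(f x, f y) \<in> parcs H'"
    then obtain a b where ab: "(a, b) \<in> parcs H" "f a = f x" "f b = f y" by (auto simp: H'_def)
    then have "a = x" "b = y" using sub inj that by (auto dest: inj_onD)
    then show "(x, y) \<in> parcs H" using ab by simp
  qed (force simp: H'_def)
  have pg': "pair_graph H'"
    unfolding pair_graph_iff
  proof (intro conjI allI)
    show "finite (pverts H')" using fin by (simp add: H'_def)
    show "parcs H' \<subseteq> pverts H' \<times> pverts H'" using sub by (auto simp: H'_def)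
    show "sym (parcs H')" using sy by (force simp: H'_def sym_def)
    show "(x, x) \<notin> parcs H'" for x
    proof
      assume "(x, x) \<in> parcs H'"
      then obtain a b where ab: "(a, b) \<in> parcs H" "f a = x" "f b = x" by (auto simp: H'_def)
      then have "a = b" using sub inj by (auto dest: inj_onD)
      then show False using ab irr by simp
    qed
  qed
  note Lsub = dp_cover_partD[OF c]
  have LL': "L' ` pverts G = (`) f ` (L ` pverts G)" by (auto simp: L'_def)
  have part: "partition_on (pverts H) (L ` pverts G)" using c by (simp add: dp_cover_def)
  have inj2: "inj_on ((`) f) (Pow (pverts H))" using inj by (rule inj_on_image_Pow)
  have mat: "matching ((`) f ` M)" if "matching M" "M \<subseteq> Pow (pverts H)" for M
    unfolding matching_def
  proof (rule disjointI)
    fix a b assume "a \<in> (`) f ` M" "b \<in> (`) f ` M" and ne: "a \<noteq> b"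
    then obtain p q where pq: "p \<in> M" "q \<in> M" "a = f ` p" "b = f ` q" by auto
    then have "p \<noteq> q" using ne by blast
    then have "p \<inter> q = {}" using that pq by (simp add: matching_def disjoint_def)
    moreover have "f ` (p \<inter> q) = f ` p \<inter> f ` q"
      using inj that pq by (intro inj_on_image_Int[of f "pverts H"]) auto
    ultimately show "a \<inter> b = {}" using pq by auto
  qed
  have part': "partition_on (pverts H') (L' ` pverts G)"
    unfolding partition_on_def LL'
  proof (intro conjI)
    show "\<Union> ((`) f ` L ` pverts G) = pverts H'"
    proof -
      have "\<Union> ((`) f ` L ` pverts G) = f ` \<Union> (L ` pverts G)" by blast
      also have "\<Union> (L ` pverts G) = pverts H" using part by (simp add: partition_on_def)
      finally show ?thesis by (simp add: H'_def)
    qed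
    show "disjoint ((`) f ` L ` pverts G)"
      using mat[of "L ` pverts G"] part Lsub by (auto simp: partition_on_def matching_def)
    show "{} \<notin> (`) f ` L ` pverts G"
      using part by (auto simp: partition_on_def)
  qed
  have card': "card (L' ` pverts G) = card (pverts G)"
  proof -
    have "inj_on ((`) f) (L ` pverts G)"
      using inj2 by (rule inj_on_subset) (use Lsub in auto)
    then show ?thesis unfolding LL' using c by (simp add: card_image dp_cover_def)
  qed
  have eb: "edges_between H' (L' u) (L' v) = (`) f ` edges_between H (L u) (L v)"
    if "u \<in> pverts G" "v \<in> pverts G" for u v
  proof -
    have "edges_between H' (L' u) (L' v) =
        {{f x, f y} | x y. x \<in> L u \<and> y \<in> L v \<and> (f x, f y) \<in> parcs H'}"
      by (auto simp: edges_between_def L'_def)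
    also have "\<dots> = {{f x, f y} | x y. x \<in> L u \<and> y \<in> L v \<and> (x, y) \<in> parcs H}"
    proof -
      have "x \<in> L u \<and> y \<in> L v \<and> (f x, f y) \<in> parcs H' \<longleftrightarrow>
          x \<in> L u \<and> y \<in> L v \<and> (x, y) \<in> parcs H" for x y
        using Lsub[OF that(1)] Lsub[OF that(2)] arc[of x y] by auto
      then show ?thesis by simp
    qed
    also have "\<dots> = {f ` e | e. \<exists>x y. e = {x, y} \<and> x \<in> L u \<and> y \<in> L v \<and> (x, y) \<in> parcs H}"
      by (rule Collect_cong) (metis image_empty image_insert)
    also have "\<dots> = (`) f ` edges_between H (L u) (L v)"
      by (simp add: edges_between_def image_Collect)
    finally show ?thesis .
  qed
  have cov: "dp_cover G L' H'"
    unfolding dp_cover_def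
  proof (intro conjI ballI impI)
    fix u assume u: "u \<in> pverts G"
    have "L' u \<subseteq> pverts H'" using Lsub[OF u] by (auto simp: L'_def H'_def)
    moreover have "\<forall>x\<in>L u. \<forall>y\<in>L u. x \<noteq> y \<longrightarrow> (x, y) \<in> parcs H"
      using c u complete_induced_iff[OF pg Lsub[OF u]] by (auto simp: dp_cover_def)
    ultimately show "complete_digraph (card (L' u)) (with_proj H' \<restriction> L' u)"
      using Lsub[OF u] arc
      by (subst complete_induced_iff[OF pg']) (auto simp: L'_def subset_iff)
  next
    fix u v assume uv: "u \<in> pverts G" "v \<in> pverts G"
    show "u = v \<or> (u, v) \<in> parcs G" if "edges_between H' (L' u) (L' v) \<noteq> {}"
      using c uv that unfolding eb[OF uv] by (auto simp: dp_cover_def)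
    show "matching (edges_between H' (L' u) (L' v))" if "(u, v) \<in> parcs G"
      unfolding eb[OF uv]
    proof (rule mat)
      show "matching (edges_between H (L u) (L v))" using c uv that by (auto simp: dp_cover_def)
      show "edges_between H (L u) (L v) \<subseteq> Pow (pverts H)"
        using Lsub uv by (auto simp: edges_between_def)
    qed
  qed (use pg' part' card' in auto)
  moreover have "card (L' u) = m" if "u \<in> pverts G" for u
    using m[OF that] inj_on_subset[OF inj Lsub[OF that]] by (simp add: L'_def card_image)
  ultimately have "fold_cover m G L' H'" by (simp add: fold_cover_def)
  moreover have "dp_colorings G H' = (`) f ` dp_colorings G H"
  proof -
    have col: "f ` T \<in> dp_colorings G H' \<longleftrightarrow> T \<in> dp_colorings G H" if T: "T \<subseteq> pverts H" for T
    proof -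
      have "card (f ` T) = card T" using inj_on_subset[OF inj T] by (rule card_image)
      moreover have "f ` T \<subseteq> pverts H'" using T by (auto simp: H'_def)
      moreover have "(\<forall>x\<in>T. \<forall>y\<in>T. (f x, f y) \<notin> parcs H') \<longleftrightarrow> (\<forall>x\<in>T. \<forall>y\<in>T. (x, y) \<notin> parcs H)"
        using T by (intro ball_cong refl) (simp add: arc subset_iff)
      ultimately show ?thesis using T by (simp add: dp_colorings_def independent_set_def)
    qed
    have "S \<subseteq> f ` pverts H" if "S \<in> dp_colorings G H'" for S
      using that by (simp add: dp_colorings_def independent_set_def H'_def)
    moreover have "T \<subseteq> pverts H" if "T \<in> dp_colorings G H" for T
      using that by (simp add: dp_colorings_def independent_set_def)
    ultimately show ?thesis using col
      by (intro equalityI subsetI) (metis image_eqI subset_image_iff, metis imageE)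
  qed
  moreover have "inj_on ((`) f) (dp_colorings G H)"
    using inj2 by (rule inj_on_subset) (auto simp: dp_colorings_def independent_set_def)
  ultimately show thesis using that by (simp add: card_image)
qed

lemma fold_cover_exists:
  assumes "pair_graph G" "m > 0"
  shows "\<exists>L (H :: ('a \<times> nat) pair_pre_digraph). fold_cover m (G :: 'a pair_pre_digraph) L H"
proof -
  define H :: "('a \<times> nat) pair_pre_digraph" where
    "H = \<lparr>pverts = pverts G \<times> {..<m},
          parcs = {((u, i), (u, j)) | u i j. u \<in> pverts G \<and> i < m \<and> j < m \<and> i \<noteq> j}\<rparr>"
  define L where "L u = {u} \<times> {..<m}" for u :: 'a
  have fin: "finite (pverts G)" and irr: "\<And>x. (x, x) \<notin> parcs G"
    using assms by (auto simp: pair_graph_iff)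
  have pg: "pair_graph H" using fin by (auto simp: pair_graph_iff H_def sym_def)
  have "inj_on L (pverts G)" using assms(2) by (auto simp: L_def inj_on_def)
  then have "card (L ` pverts G) = card (pverts G)" by (rule card_image)
  moreover have "partition_on (pverts H) (L ` pverts G)"
    using assms(2) by (auto simp: partition_on_def disjoint_def L_def H_def)
  moreover have "complete_digraph (card (L u)) (with_proj H \<restriction> L u)" if "u \<in> pverts G" for u
    using that by (subst complete_induced_iff[OF pg]) (auto simp: L_def H_def)
  moreover have "edges_between H (L u) (L v) = {}" if "u \<noteq> v" for u v
    using that by (auto simp: edges_between_def L_def H_def)
  moreover have "matching (edges_between H (L u) (L v))" if "(u, v) \<in> parcs G" for u v
  proof -
    have "edges_between H (L u) (L v) = {}"
      using that irr by (auto simp: edges_between_def L_def H_def)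
    then show ?thesis by (simp add: matching_def disjoint_def)
  qed
  ultimately have "dp_cover G L H"
    using pg unfolding dp_cover_def by blast
  then have "fold_cover m G L H" by (simp add: fold_cover_def L_def)
  then show ?thesis by blast
qed

lemma dp_color_function_le:
  assumes "fold_cover m G L H"
  shows "dp_color_function G m \<le> card (dp_colorings G H)"
proof -
  obtain L' and H' :: "nat pair_pre_digraph" where
    "fold_cover m G L' H'" "card (dp_colorings G H') = card (dp_colorings G H)"
    using assms by (rule fold_cover_nat)
  then show ?thesis
    unfolding dp_color_function_def by (intro Least_le exI[of _ L'] exI[of _ H']) simp
qed

lemma dp_color_function_attained:
  assumes "pair_graph (G :: 'a pair_pre_digraph)" "m > 0"
  obtains L and H :: "nat pair_pre_digraph" where
    "fold_cover m G L H" "dp_color_function G m = card (dp_colorings G H)"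
proof -
  obtain L1 and H1 :: "('a \<times> nat) pair_pre_digraph" where "fold_cover m G L1 H1"
    using fold_cover_exists[OF assms] by blast
  then obtain L0 and H0 :: "nat pair_pre_digraph" where "fold_cover m G L0 H0"
    by (rule fold_cover_nat)
  then have "\<exists>k L (H :: nat pair_pre_digraph). fold_cover m G L H \<and> k = card (dp_colorings G H)"
    by blast
  from LeastI_ex[OF this] show thesis
    using that unfolding dp_color_function_def by blast
qed

lemma equiv_identify_rel:
  assumes "A \<subseteq> V" "B \<subseteq> V" "A \<inter> B = {}"
  shows "equiv V (identify_rel V A B)"
proof (rule equivI)
  show "identify_rel V A B \<subseteq> V \<times> V" "refl_on V (identify_rel V A B)"
    "sym (identify_rel V A B)"
    using assms by (auto simp: identify_rel_def refl_on_def sym_def)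
  show "trans (identify_rel V A B)"
    using assms by (intro transI) (auto simp: identify_rel_def)
qed

lemma pair_graph_edge_gluing:
  assumes fin: "finite I" and pg: "\<And>i. i \<in> I \<Longrightarrow> pair_graph (G i)"
    and disj: "disjoint_family_on (\<lambda>i. pverts (G i)) I"
    and uv: "\<And>i. i \<in> I \<Longrightarrow> (u i, v i) \<in> parcs (G i)"
  shows "equiv (pverts (graph_Union I G)) (identify_rel (pverts (graph_Union I G)) (u ` I) (v ` I))"
    and "pair_graph (edge_gluing I G u v)"
proof -
  let ?U = "graph_Union I G"
  define r where "r = identify_rel (pverts ?U) (u ` I) (v ` I)"
  have uv': "u i \<in> pverts (G i)" "v i \<in> pverts (G i)" "u i \<noteq> v i" if "i \<in> I" for i
    using pg[OF that] uv[OF that] unfolding pair_graph_iff by (fastforce, fastforce, metis)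
  have same: "i = j" if "x \<in> pverts (G i)" "x \<in> pverts (G j)" "i \<in> I" "j \<in> I" for i j x
    using disj that by (auto simp: disjoint_family_on_def)
  have ne: "u i \<noteq> v j" if "i \<in> I" "j \<in> I" for i j
    using uv'[OF that(1)] uv'[OF that(2)] same that by metis
  show eq: "equiv (pverts ?U) (identify_rel (pverts ?U) (u ` I) (v ` I))"
  proof (rule equiv_identify_rel)
    show "u ` I \<subseteq> pverts ?U" "v ` I \<subseteq> pverts ?U"
      using uv' by (auto simp: graph_Union_def)
    show "u ` I \<inter> v ` I = {}" using ne by blast
  qed
  have sub: "parcs ?U \<subseteq> pverts ?U \<times> pverts ?U"
    using pg by (fastforce simp: graph_Union_def pair_graph_iff)
  have sy: "sym (parcs ?U)" using pg by (fastforce simp: graph_Union_def pair_graph_iff sym_def)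
  have nr: "(x, y) \<notin> r" if e: "(x, y) \<in> parcs ?U" for x y
  proof
    assume xy: "(x, y) \<in> r"
    obtain i where i: "i \<in> I" "(x, y) \<in> parcs (G i)" using e by (auto simp: graph_Union_def)
    then have V: "x \<in> pverts (G i)" "y \<in> pverts (G i)" "x \<noteq> y"
      using pg[OF i(1)] by (auto simp: pair_graph_iff)
    from xy V(3) consider "x \<in> u ` I" "y \<in> u ` I" | "x \<in> v ` I" "y \<in> v ` I"
      by (auto simp: r_def identify_rel_def)
    then show False
    proof cases
      case 1
      then obtain j k where "x = u j" "j \<in> I" "y = u k" "k \<in> I" by auto
      then have "j = i" "k = i" using V i same uv' by metis+
      with \<open>x = u j\<close> \<open>y = u k\<close> V(3) show False by simp
    next
      case 2
      then obtain j k where "x = v j" "j \<in> I" "y = v k" "k \<in> I" by auto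
      then have "j = i" "k = i" using V i same uv' by metis+
      with \<open>x = v j\<close> \<open>y = v k\<close> V(3) show False by simp
    qed
  qed
  show "pair_graph (edge_gluing I G u v)"
    unfolding pair_graph_iff edge_gluing_def r_def[symmetric] quotient_graph_def
      pair_pre_digraph.select_convs
  proof (intro conjI allI)
    have "finite (pverts ?U)" using fin pg by (auto simp: graph_Union_def pair_graph_iff)
    then show "finite (pverts ?U // r)" by (simp add: quotient_def)
    show "(\<lambda>(x, y). (r `` {x}, r `` {y})) ` parcs ?U \<subseteq> pverts ?U // r \<times> pverts ?U // r"
      using sub by (auto intro!: quotientI)
    show "sym ((\<lambda>(x, y). (r `` {x}, r `` {y})) ` parcs ?U)"
      using sy by (force simp: sym_def)
    show "(X, X) \<notin> (\<lambda>(x, y). (r `` {x}, r `` {y})) ` parcs ?U" for X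
    proof
      assume "(X, X) \<in> (\<lambda>(x, y). (r `` {x}, r `` {y})) ` parcs ?U"
      then obtain x y where xy: "(x, y) \<in> parcs ?U" "r `` {x} = r `` {y}" by auto
      then have "y \<in> pverts ?U" using sub by auto
      with xy(2) have "(x, y) \<in> r" by (rule eq_equiv_class[OF _ eq[folded r_def]])
      with nr[OF xy(1)] show False by simp
    qed
  qed
qed

end

theory Submission
  imports Defs "HOL-Combinatorics.Permutations"
begin

text \<open>
  Take an optimal cover of each \<open>G\<^sub>i\<close> and name the colors so that the matching over \<open>u\<^sub>iv\<^sub>i\<close> is the
  identity. For any permutations \<open>\<sigma>\<^sub>i\<close> of the colors, permuting the colors of the \<open>i\<close>-th cover by
  \<open>\<sigma>\<^sub>i\<close> keeps this property, so the permuted covers can be glued to a cover of \<open>G\<close>. If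
  \<open>N\<^sub>i(a, b)\<close> colorings of the \<open>i\<close>-th cover give \<open>u\<^sub>i\<close> and \<open>v\<^sub>i\<close> the colors \<open>a \<noteq> b\<close>, the glued
  cover has \<open>\<Sum>\<^sub>a\<^sub>\<noteq>\<^sub>b \<Prod>\<^sub>i N\<^sub>i(\<sigma>\<^sub>i a, \<sigma>\<^sub>i b)\<close> colorings. For independent uniformly random \<open>\<sigma>\<^sub>i\<close>,
  each factor averages to \<open>P\<^sub>D\<^sub>P(G\<^sub>i, m) / (m(m - 1))\<close>, so the expected number of colorings is at
  most the asserted bound.
\<close>

section \<open>Covers in normal form and colorings as functions\<close>

text \<open>An \<open>m\<close>-fold cover up to renaming: the part over \<open>x\<close> is \<open>{x} \<times> {..<m}\<close>, and \<open>R\<close> contains only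
  the arcs between distinct parts. Colorings then become functions on the vertices of \<open>G\<close>.\<close>

definition correspondence :: "'a pair_pre_digraph \<Rightarrow> nat \<Rightarrow> ('a \<times> nat) rel \<Rightarrow> bool" where
  "correspondence G m R \<longleftrightarrow> sym R \<and>
     (\<forall>x i y j. ((x, i), (y, j)) \<in> R \<longrightarrow> (x, y) \<in> parcs G \<and> i < m \<and> j < m) \<and>
     (\<forall>x i y j k. ((x, i), (y, j)) \<in> R \<longrightarrow> ((x, i), (y, k)) \<in> R \<longrightarrow> j = k)"

definition corr_colorings ::
  "'a pair_pre_digraph \<Rightarrow> nat \<Rightarrow> ('a \<times> nat) rel \<Rightarrow> ('a \<Rightarrow> nat) set" where
  "corr_colorings G m R =
     {c \<in> pverts G \<rightarrow>\<^sub>E {..<m}. \<forall>x\<in>pverts G. \<forall>y\<in>pverts G. ((x, c x), (y, c y)) \<notin> R}"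

lemma finite_corr_colorings:
  assumes "pair_graph G"
  shows "finite (corr_colorings G m R)"
proof (rule finite_subset)
  show "corr_colorings G m R \<subseteq> pverts G \<rightarrow>\<^sub>E {..<m}" by (auto simp: corr_colorings_def)
  show "finite (pverts G \<rightarrow>\<^sub>E {..<m})" using assms by (simp add: pair_graph_iff finite_PiE)
qed

text \<open>Each part is a clique, so an independent set meets it at most once; having
  \<open>card (pverts G)\<close> elements, it meets every part exactly once. The naming
  \<open>g\<close> of the colors is arbitrary, to serve both covers built from a correspondence and
  a given optimal cover.\<close>

lemma bij_betw_dp_colorings:
  assumes pg: "pair_graph G" and cov: "fold_cover m G L H"
    and g: "\<And>x. x \<in> pverts G \<Longrightarrow> bij_betw (g x) {..<m} (L x)"
  shows "bij_betw (\<lambda>c. (\<lambda>x. g x (c x)) ` pverts G)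
    {c \<in> pverts G \<rightarrow>\<^sub>E {..<m}. \<forall>x\<in>pverts G. \<forall>y\<in>pverts G. (g x (c x), g y (c y)) \<notin> parcs H}
    (dp_colorings G H)" (is "bij_betw ?F ?C _")
proof -
  let ?V = "pverts G"
  have c: "dp_cover G L H" using cov by (simp add: fold_cover_def)
  have pgH: "pair_graph H" using c by (simp add: dp_cover_def)
  have finV: "finite ?V" using pg by (simp add: pair_graph_iff)
  note Lsub = dp_cover_partD[OF c]
  have injL: "inj_on L ?V" using c finV by (auto simp: dp_cover_def intro: eq_card_imp_inj_on)
  have part: "partition_on (pverts H) (L ` ?V)" using c by (simp add: dp_cover_def)
  have same: "x = y" if "x \<in> ?V" "y \<in> ?V" "a \<in> L x" "a \<in> L y" for x y a
  proof -
    have "L x = L y" using part that by (auto simp: partition_on_def disjoint_def)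
    then show ?thesis using injL that by (auto dest: inj_onD)
  qed
  have complete: "(a, b) \<in> parcs H" if "x \<in> ?V" "a \<in> L x" "b \<in> L x" "a \<noteq> b" for x a b
    using c that complete_induced_iff[OF pgH Lsub[OF that(1)]] by (auto simp: dp_cover_def)
  have gL: "g x i \<in> L x" if "x \<in> ?V" "i < m" for x i
    using g[OF that(1)] that(2) by (auto simp: bij_betw_def)
  have inj: "inj_on (\<lambda>x. g x (d x)) ?V" if "d \<in> ?V \<rightarrow>\<^sub>E {..<m}" for d
  proof (rule inj_onI)
    fix x y assume xy: "x \<in> ?V" "y \<in> ?V" "g x (d x) = g y (d y)"
    then have "g x (d x) \<in> L x" "g x (d x) \<in> L y"
      using that gL[of x "d x"] gL[of y "d y"] by (auto simp: PiE_iff)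
    then show "x = y" using same xy by blast
  qed
  show ?thesis
    unfolding bij_betw_def
  proof (intro conjI equalityI subsetI)
    show "inj_on ?F ?C"
    proof (rule inj_onI)
      fix d e assume de: "d \<in> ?C" "e \<in> ?C" "?F d = ?F e"
      have "d x = e x" if x: "x \<in> ?V" for x
      proof -
        have "g x (d x) \<in> ?F e" using x de(3) by blast
        then obtain y where y: "y \<in> ?V" "g x (d x) = g y (e y)" by auto
        have lt: "d x < m" "e y < m" "e x < m" using de x y by (auto simp: PiE_iff)
        have "y = x" using same[OF y(1) x] gL[OF y(1) lt(2)] gL[OF x lt(1)] y(2) by simp
        then show ?thesis using y(2) g[OF x] lt by (auto simp: bij_betw_def inj_on_def)
      qed
      then show "d = e" using de by (auto intro: PiE_ext)
    qed
  next
    fix S assume "S \<in> ?F ` ?C"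
    then obtain d where d: "d \<in> ?C" "S = ?F d" by blast
    have "card S = card ?V" unfolding d(2) by (rule card_image) (use d inj in auto)
    moreover have "g x (d x) \<in> pverts H" if "x \<in> ?V" for x
      using gL[OF that, of "d x"] Lsub[OF that] d(1) that by (auto simp: PiE_iff)
    then have "S \<subseteq> pverts H" using d by auto
    ultimately show "S \<in> dp_colorings G H"
      using d by (auto simp: dp_colorings_def independent_set_def)
  next
    fix S assume S: "S \<in> dp_colorings G H"
    then have SH: "S \<subseteq> pverts H" and ind: "\<And>a b. a \<in> S \<Longrightarrow> b \<in> S \<Longrightarrow> (a, b) \<notin> parcs H"
      and cS: "card S = card ?V"
      by (auto simp: dp_colorings_def independent_set_def)
    have "\<forall>s\<in>S. \<exists>x\<in>?V. s \<in> L x" using SH part by (auto simp: partition_on_def)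
    then obtain p where p: "\<And>s. s \<in> S \<Longrightarrow> p s \<in> ?V" "\<And>s. s \<in> S \<Longrightarrow> s \<in> L (p s)" by metis
    \<comment> \<open>Two distinct elements of \<open>S\<close> in one part would be adjacent.
      Counting then makes \<open>p\<close> reach every vertex.\<close>
    have "inj_on p S"
  proof (rule inj_onI)
      fix a b assume ab: "a \<in> S" "b \<in> S" "p a = p b"
      then show "a = b" using complete[of "p a" a b] p[of a] p[of b] ind[of a b] by auto
    qed
    then have "card (p ` S) = card ?V" using cS by (simp add: card_image)
    then have pS: "p ` S = ?V" using p finV by (intro card_subset_eq) auto
    have "\<exists>i<m. g x i \<in> S" if x: "x \<in> ?V" for x
    proof -
      obtain s where "s \<in> S" "x = p s" using x pS by blast
      then have s: "s \<in> S" "s \<in> L x" using p by auto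
      then have "s \<in> g x ` {..<m}" using g[OF x] by (simp add: bij_betw_def)
      then show ?thesis using s(1) by auto
    qed
    then obtain d where d: "\<And>x. x \<in> ?V \<Longrightarrow> d x < m" "\<And>x. x \<in> ?V \<Longrightarrow> g x (d x) \<in> S" by metis
    \<comment> \<open>The restriction makes \<open>e\<close> take the value \<open>undefined\<close>
      off the vertex set, as an extensional function must.\<close>
    define e where "e = restrict d ?V"
    have "e \<in> ?C" using d ind by (auto simp: e_def)
    moreover have "S = ?F e"
    proof
      show "?F e \<subseteq> S" using d by (auto simp: e_def)
      show "S \<subseteq> ?F e"
      proof
        fix s assume s: "s \<in> S"
        have "s = g (p s) (d (p s))"
          using complete[OF p(1)[OF s] p(2)[OF s] gL[OF p(1)[OF s] d(1)[OF p(1)[OF s]]]]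
            ind[OF s d(2)[OF p(1)[OF s]]] by blast
        then show "s \<in> ?F e" using p(1)[OF s] by (auto simp: e_def)
      qed
    qed
    ultimately show "S \<in> ?F ` ?C" by blast
  qed
qed

text \<open>A clique placed over every vertex turns \<open>R\<close> into a cover. The clique arcs
  exclude no function, since a function picks one color per vertex. Positivity of \<open>m\<close>
  keeps the parts nonempty, as \<open>partition_on\<close> demands.\<close>

lemma dp_color_function_le_corr:
  assumes pg: "pair_graph G" and R: "correspondence G m R" and "m > 0"
  shows "dp_color_function G m \<le> card (corr_colorings G m R)"
proof -
  let ?V = "pverts G"
  define H where "H = \<lparr>pverts = ?V \<times> {..<m},
    parcs = R \<union> {((x, i), (x, j)) | x i j. x \<in> ?V \<and> i < m \<and> j < m \<and> i \<noteq> j}\<rparr>"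
  define L where "L x = {x} \<times> {..<m}" for x :: 'a
  have fin: "finite ?V" and irr: "\<And>x. (x, x) \<notin> parcs G" and sub: "parcs G \<subseteq> ?V \<times> ?V"
    using pg by (auto simp: pair_graph_iff)
  have sy: "sym R" and Rsub: "\<And>x i y j. ((x, i), (y, j)) \<in> R \<Longrightarrow> (x, y) \<in> parcs G \<and> i < m \<and> j < m"
    and mat: "\<And>x i y j k. ((x, i), (y, j)) \<in> R \<Longrightarrow> ((x, i), (y, k)) \<in> R \<Longrightarrow> j = k"
    using R by (auto simp: correspondence_def)
  \<comment> \<open>Uniqueness of the partner at one end of a matching arc passes to the other end
    by symmetry.\<close>
  have mat': "i = k" if "((x, i), (y, j)) \<in> R" "((x, k), (y, j)) \<in> R" for x i y j k
    using mat that sy by (meson symE)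
  have pgH: "pair_graph H"
    unfolding pair_graph_iff
  proof (intro conjI allI)
    show "finite (pverts H)" using fin by (simp add: H_def)
    show "parcs H \<subseteq> pverts H \<times> pverts H" using sub by (auto simp: H_def dest!: Rsub)
    show "sym (parcs H)" using sy by (auto simp: H_def sym_def)
    show "(x, x) \<notin> parcs H" for x using irr by (cases x) (auto simp: H_def dest: Rsub)
  qed
  have "inj_on L ?V" using assms(3) by (auto simp: L_def inj_on_def)
  then have "card (L ` ?V) = card ?V" by (rule card_image)
  moreover have "partition_on (pverts H) (L ` ?V)"
    using assms(3) by (auto simp: partition_on_def disjoint_def L_def H_def)
  moreover have "complete_digraph (card (L x)) (with_proj H \<restriction> L x)" if "x \<in> ?V" for x
    using that by (subst complete_induced_iff[OF pgH]) (auto simp: L_def H_def)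
  moreover have "x = y \<or> (x, y) \<in> parcs G" if "edges_between H (L x) (L y) \<noteq> {}" for x y
    using that by (auto simp: edges_between_def L_def H_def dest!: Rsub)
  moreover have "matching (edges_between H (L x) (L y))" if xy: "(x, y) \<in> parcs G" for x y
  proof -
    have ne: "x \<noteq> y" using xy irr by auto
    then have eb: "edges_between H (L x) (L y) = {{(x, i), (y, j)} | i j. ((x, i), (y, j)) \<in> R}"
      by (auto simp: edges_between_def L_def H_def dest: Rsub)
    have ef: "e = f" if "e = {(x, i), (y, j)}" "((x, i), (y, j)) \<in> R"
      "f = {(x, i'), (y, j')}" "((x, i'), (y, j')) \<in> R" "e \<inter> f \<noteq> {}" for e f i j i' j'
    proof -
      have "i = i' \<or> j = j'" using that ne by auto
      then show ?thesis using that mat mat' by metis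
    qed
    show ?thesis
      unfolding matching_def eb
    proof (rule disjointI)
      fix e f
      assume "e \<in> {{(x, i), (y, j)} | i j. ((x, i), (y, j)) \<in> R}"
        "f \<in> {{(x, i), (y, j)} | i j. ((x, i), (y, j)) \<in> R}" and "e \<noteq> f"
      then obtain i j i' j' where "e = {(x, i), (y, j)}" "((x, i), (y, j)) \<in> R"
        "f = {(x, i'), (y, j')}" "((x, i'), (y, j')) \<in> R" by blast
      then show "e \<inter> f = {}" using ef[of e i j f i' j'] \<open>e \<noteq> f\<close> by argo
    qed
  qed
  ultimately have "dp_cover G L H"
    using pgH unfolding dp_cover_def by blast
  then have cov: "fold_cover m G L H" by (simp add: fold_cover_def L_def)
  have "bij_betw (Pair x) {..<m} (L x)" for x by (auto simp: L_def bij_betw_def inj_on_def)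
  from bij_betw_same_card[OF bij_betw_dp_colorings[OF pg cov, of Pair, OF this]]
  have "card (dp_colorings G H) = card {c \<in> ?V \<rightarrow>\<^sub>E {..<m}. \<forall>x\<in>?V. \<forall>y\<in>?V.
      ((x, c x), (y, c y)) \<notin> parcs H}" by simp
  also have "{c \<in> ?V \<rightarrow>\<^sub>E {..<m}. \<forall>x\<in>?V. \<forall>y\<in>?V. ((x, c x), (y, c y)) \<notin> parcs H}
      = corr_colorings G m R"
    by (auto simp: corr_colorings_def H_def)
  finally show ?thesis using dp_color_function_le[OF cov] by simp
qed

section \<open>Making the matching over one edge the identity\<close>

lemma extend_to_bij_betw:
  assumes "finite A" "finite B" "card A = card B" "D \<subseteq> A" "f ` D \<subseteq> B" "inj_on f D"
  obtains h where "bij_betw h A B" "\<And>x. x \<in> D \<Longrightarrow> h x = f x"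
proof -
  have fin: "finite D" using assms(1,4) by (rule rev_finite_subset)
  have "card (f ` D) = card D" using assms(6) by (rule card_image)
  then have "card (A - D) = card (B - f ` D)"
    using assms(3,4,5) fin by (simp add: card_Diff_subset)
  then obtain k where k: "bij_betw k (A - D) (B - f ` D)"
    using finite_same_card_bij[OF finite_Diff[OF assms(1)] finite_Diff[OF assms(2)]] by blast
  define h where "h x = (if x \<in> D then f x else k x)" for x
  have "bij_betw h D (f ` D)"
    using inj_on_imp_bij_betw[OF assms(6)] by (simp add: h_def cong: bij_betw_cong)
  moreover have "bij_betw h (A - D) (B - f ` D)"
    using k bij_betw_cong[of "A - D" h k] by (simp add: h_def)
  ultimately have "bij_betw h (D \<union> (A - D)) (f ` D \<union> (B - f ` D))"
    by (rule bij_betw_combine) auto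
  moreover have "D \<union> (A - D) = A" "f ` D \<union> (B - f ` D) = B" using assms by auto
  ultimately show thesis using that[of h] by (simp add: h_def)
qed

text \<open>Completing the matching over the edge \<open>uv\<close> only destroys colorings, and relabelling the
  colors at \<open>v\<close> turns this perfect matching into the identity.\<close>

lemma corr_straight_edge:
  assumes pg: "pair_graph G" and uv: "(u, v) \<in> parcs G" and m: "m > 0"
  obtains R where "correspondence G m R" "\<And>i. i < m \<Longrightarrow> ((u, i), (v, i)) \<in> R"
    "card (corr_colorings G m R) \<le> dp_color_function G m"
proof -
  let ?V = "pverts G"
  obtain L and H :: "nat pair_pre_digraph" where cov: "fold_cover m G L H"
    and att: "dp_color_function G m = card (dp_colorings G H)"
    using dp_color_function_attained[OF pg m] .
  have c: "dp_cover G L H" and cL: "\<And>x. x \<in> ?V \<Longrightarrow> card (L x) = m"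
    using cov by (auto simp: fold_cover_def)
  have pgH: "pair_graph H" using c by (simp add: dp_cover_def)
  \<comment> \<open>An infinite set has \<open>card\<close> 0, so \<open>m > 0\<close> forces the
    parts to be finite.\<close>
  have finL: "finite (L x)" if "x \<in> ?V" for x
    using cL[OF that] m by (metis card.infinite less_numeral_extra(3))
  have syG: "sym (parcs G)" and VV: "\<And>x y. (x, y) \<in> parcs G \<Longrightarrow> x \<in> ?V \<and> y \<in> ?V \<and> x \<noteq> y"
    using pg by (auto simp: pair_graph_iff)
  have syH: "sym (parcs H)" using pgH by (simp add: pair_graph_iff)
  have u: "u \<in> ?V" and v: "v \<in> ?V" and ne: "u \<noteq> v" using VV[OF uv] by auto
  have mat: "b = b'" if "(x, y) \<in> parcs G" "a \<in> L x" "b \<in> L y" "b' \<in> L y"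
    "(a, b) \<in> parcs H" "(a, b') \<in> parcs H" for x y a b b'
  proof -
    have "disjoint (edges_between H (L x) (L y))"
      using c that(1) VV unfolding dp_cover_def matching_def by blast
    moreover have "{a, b} \<in> edges_between H (L x) (L y)" "{a, b'} \<in> edges_between H (L x) (L y)"
      using that by (auto simp: edges_between_def)
    ultimately have "{a, b} = {a, b'}" using disjointD by (metis Int_insert_left_if1 insertI1 insert_not_empty)
    then show ?thesis by (auto simp: doubleton_eq_iff)
  qed
  \<comment> \<open>\<open>D\<close> holds the colors at \<open>u\<close> that are matched over the
    edge, \<open>f\<close> gives their partners, and \<open>h\<close> below is a perfect matching
    extending \<open>f\<close>.\<close>
  define D where "D = {a \<in> L u. \<exists>b\<in>L v. (a, b) \<in> parcs H}"
  have "\<forall>a\<in>D. \<exists>b. b \<in> L v \<and> (a, b) \<in> parcs H" by (auto simp: D_def)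
  then obtain f where f: "\<And>a. a \<in> D \<Longrightarrow> f a \<in> L v" "\<And>a. a \<in> D \<Longrightarrow> (a, f a) \<in> parcs H"
    by metis
  have vu: "(v, u) \<in> parcs G" using uv syG by (auto dest: symD)
  have "inj_on f D"
  proof (rule inj_onI)
    fix a a' assume a: "a \<in> D" "a' \<in> D" "f a = f a'"
    have "(f a, a) \<in> parcs H" "(f a', a') \<in> parcs H"
      using a symD[OF syH f(2)] by blast+
    with a show "a = a'" using mat[OF vu, of "f a" a a'] f(1)[OF a(1)] by (auto simp: D_def)
  qed
  obtain h where h: "bij_betw h (L u) (L v)" "\<And>a. a \<in> D \<Longrightarrow> h a = f a"
  proof -
    have "D \<subseteq> L u" "f ` D \<subseteq> L v" using f(1) by (auto simp: D_def)
    moreover have "card (L u) = card (L v)" using cL u v by simp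
    ultimately show thesis
      using extend_to_bij_betw[of "L u" "L v" D f] finL[OF u] finL[OF v] \<open>inj_on f D\<close> that
      by blast
  qed
  have hmat: "b = h a" if "a \<in> L u" "b \<in> L v" "(a, b) \<in> parcs H" for a b
  proof -
    have "a \<in> D" using that by (auto simp: D_def)
    then show ?thesis using mat[OF uv that(1,2) f(1) that(3) f(2)] h(2) by simp
  qed
  have "\<exists>k. bij_betw k {..<m} (L x)" if "x \<in> ?V" for x
    using finL[OF that] cL[OF that] ex_bij_betw_nat_finite[of "L x"]
    by (auto simp: atLeast0LessThan)
  then obtain g0 where g0: "\<And>x. x \<in> ?V \<Longrightarrow> bij_betw (g0 x) {..<m} (L x)" by metis
  \<comment> \<open>Each color at \<open>v\<close> gets the name of its \<open>h\<close>-partner at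
    \<open>u\<close>, which makes \<open>h\<close> the identity on names.\<close>
  define g where "g = g0(v := h \<circ> g0 u)"
  have g: "bij_betw (g x) {..<m} (L x)" if "x \<in> ?V" for x
    using that g0 h(1) u by (auto simp: g_def intro: bij_betw_trans)
  have gL: "g x i \<in> L x" if "x \<in> ?V" "i < m" for x i
    using g[OF that(1)] that(2) by (auto simp: bij_betw_def)
  have ginj: "i = j" if "x \<in> ?V" "i < m" "j < m" "g x i = g x j" for x i j
    using g[OF that(1)] that by (auto simp: bij_betw_def inj_on_def)
  \<comment> \<open>The last disjunct supplies the arcs of \<open>h\<close> that \<open>H\<close>
    may lack; both directions are listed to keep \<open>R\<close> symmetric.\<close>
  define R where "R = {((x, i), (y, j)). (x, y) \<in> parcs G \<and> i < m \<and> j < m \<and>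
     ((g x i, g y j) \<in> parcs H \<or> (i = j \<and> ((x, y) = (u, v) \<or> (x, y) = (v, u))))}"
  have guv: "g v i = h (g u i)" for i using ne by (simp add: g_def)
  \<comment> \<open>Under these names the arcs of \<open>H\<close> over \<open>uv\<close> are
    already diagonal, so the added arcs do not spoil the matching.\<close>
  have duv: "i = j" if "i < m" "j < m" "(g u i, g v j) \<in> parcs H" for i j
  proof -
    have "g v j = g v i" using hmat[OF gL gL that(3)] u v that guv by simp
    then show ?thesis using ginj[OF v] that by metis
  qed
  have dvu: "i = j" if "i < m" "j < m" "(g v i, g u j) \<in> parcs H" for i j
    using duv[of j i] that syH by (auto dest: symD)
  have "correspondence G m R"
    unfolding correspondence_def
  proof (intro conjI allI impI)
    show "sym R" using syG syH by (auto simp: R_def sym_def)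
  next
    fix x i y j k assume a: "((x, i), (y, j)) \<in> R" "((x, i), (y, k)) \<in> R"
    then have e: "(x, y) \<in> parcs G" and lt: "i < m" "j < m" "k < m" by (auto simp: R_def)
    consider "(x, y) = (u, v)" | "(x, y) = (v, u)" | "(x, y) \<noteq> (u, v)" "(x, y) \<noteq> (v, u)"
      by blast
    then show "j = k"
    proof cases
      case 1 then show ?thesis using a duv by (auto simp: R_def)
    next
      case 2 then show ?thesis using a dvu by (auto simp: R_def)
    next
      case 3
      then have "(g x i, g y j) \<in> parcs H" "(g x i, g y k) \<in> parcs H" using a by (auto simp: R_def)
      moreover have "x \<in> ?V" "y \<in> ?V" using VV[OF e] by auto
      ultimately show ?thesis using mat[OF e] gL ginj lt by metis
    qed
  qed (auto simp: R_def)
  moreover have "((u, i), (v, i)) \<in> R" if "i < m" for i using that uv by (simp add: R_def)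
  moreover have "card (corr_colorings G m R) \<le> dp_color_function G m"
  proof -
    let ?C = "{d \<in> ?V \<rightarrow>\<^sub>E {..<m}. \<forall>x\<in>?V. \<forall>y\<in>?V. (g x (d x), g y (d y)) \<notin> parcs H}"
    \<comment> \<open>\<open>R\<close> forbids whatever \<open>H\<close> forbids between chosen
      colors: an arc of \<open>H\<close> between distinct parts lies over an edge of
      \<open>G\<close>, and within one part only a loop could occur.\<close>
    have "corr_colorings G m R \<subseteq> ?C"
    proof (intro subsetI CollectI conjI ballI)
      fix d assume d: "d \<in> corr_colorings G m R"
      then show "d \<in> ?V \<rightarrow>\<^sub>E {..<m}" by (simp add: corr_colorings_def)
      then have lt: "d x < m" if "x \<in> ?V" for x using that by auto
      fix x y assume xy: "x \<in> ?V" "y \<in> ?V"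
      show "(g x (d x), g y (d y)) \<notin> parcs H"
      proof
        assume a: "(g x (d x), g y (d y)) \<in> parcs H"
        have "edges_between H (L x) (L y) \<noteq> {}"
          using a gL[OF xy(1) lt[OF xy(1)]] gL[OF xy(2) lt[OF xy(2)]]
          by (auto simp: edges_between_def)
        then have "x = y \<or> (x, y) \<in> parcs G" using c xy by (auto simp: dp_cover_def)
        moreover have "x \<noteq> y" using a pgH by (auto simp: pair_graph_iff)
        ultimately have "((x, d x), (y, d y)) \<in> R" using a lt xy by (auto simp: R_def)
        then show False using d xy by (auto simp: corr_colorings_def)
      qed
    qed
    moreover have "finite ?C"
      using pg by (intro finite_subset[OF _ finite_PiE[of ?V "\<lambda>_. {..<m}"]]) (auto simp: pair_graph_iff)
    ultimately have "card (corr_colorings G m R) \<le> card ?C" by (rule card_mono[rotated])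
    then show ?thesis
      using bij_betw_same_card[OF bij_betw_dp_colorings[OF pg cov g]] att by simp
  qed
  ultimately show thesis using that by blast
qed

section \<open>Permuting the colors of a cover\<close>

text \<open>Taken as a preimage: the new color \<open>i\<close> behaves like the old color
  \<open>\<sigma> i\<close>, so colorings are carried over by composition with
  \<open>\<sigma>\<close>.\<close>

definition permute_corr :: "(nat \<Rightarrow> nat) \<Rightarrow> ('a \<times> nat) rel \<Rightarrow> ('a \<times> nat) rel" where
  "permute_corr \<sigma> R = {((x, i), (y, j)). ((x, \<sigma> i), (y, \<sigma> j)) \<in> R}"

text \<open>For the \<open>i\<close>-th cover, the cardinality of this set is the number
  \<open>N\<^sub>i(a, b)\<close>.\<close>

definition colorings_at ::
  "'a pair_pre_digraph \<Rightarrow> nat \<Rightarrow> ('a \<times> nat) rel \<Rightarrow> 'a \<Rightarrow> 'a \<Rightarrow> nat \<Rightarrow> nat \<Rightarrow> ('a \<Rightarrow> nat) set" where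
  "colorings_at G m R u v a b = {c \<in> corr_colorings G m R. c u = a \<and> c v = b}"

lemma correspondence_permute:
  assumes "correspondence G m R" "\<sigma> permutes {..<m}"
  shows "correspondence G m (permute_corr \<sigma> R)"
proof -
  have lt: "\<sigma> i < m \<longleftrightarrow> i < m" for i using permutes_in_image[OF assms(2), of i] by simp
  have inj: "\<sigma> i = \<sigma> j \<longleftrightarrow> i = j" for i j
    using permutes_inj[OF assms(2)] by (auto dest: injD)
  have sy: "sym R" and Rsub: "\<And>x i y j. ((x, i), (y, j)) \<in> R \<Longrightarrow> (x, y) \<in> parcs G \<and> i < m \<and> j < m"
    and mat: "\<And>x i y j k. ((x, i), (y, j)) \<in> R \<Longrightarrow> ((x, i), (y, k)) \<in> R \<Longrightarrow> j = k"
    using assms(1) by (auto simp: correspondence_def)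
  show ?thesis
    unfolding correspondence_def
  proof (intro conjI allI impI)
    show "sym (permute_corr \<sigma> R)" using sy by (auto simp: sym_def permute_corr_def)
    show "j = k" if "((x, i), (y, j)) \<in> permute_corr \<sigma> R" "((x, i), (y, k)) \<in> permute_corr \<sigma> R"
      for x i y j k
      using mat[of x "\<sigma> i" y "\<sigma> j" "\<sigma> k"] that inj by (simp add: permute_corr_def)
  qed (auto simp: permute_corr_def lt dest: Rsub)
qed

text \<open>Composition with \<open>\<sigma>\<close> injects the left set into the right one, the
  direction that an upper bound calls for.\<close>

lemma card_colorings_at_permute_le:
  assumes pg: "pair_graph G" and \<sigma>: "\<sigma> permutes {..<m}" and uv: "u \<in> pverts G" "v \<in> pverts G"
  shows "card (colorings_at G m (permute_corr \<sigma> R) u v a b) \<le> card (colorings_at G m R u v (\<sigma> a) (\<sigma> b))"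
proof (rule card_inj_on_le)
  let ?F = "\<lambda>c. \<lambda>x\<in>pverts G. \<sigma> (c x)"
  have lt: "\<sigma> i < m \<longleftrightarrow> i < m" for i using permutes_in_image[OF \<sigma>, of i] by simp
  have inj: "\<sigma> i = \<sigma> j \<longleftrightarrow> i = j" for i j
    using permutes_inj[OF \<sigma>] by (auto dest: injD)
  show "inj_on ?F (colorings_at G m (permute_corr \<sigma> R) u v a b)"
  proof (rule inj_onI)
    fix c d
    assume cd: "c \<in> colorings_at G m (permute_corr \<sigma> R) u v a b"
      "d \<in> colorings_at G m (permute_corr \<sigma> R) u v a b" "?F c = ?F d"
    have "c x = d x" if "x \<in> pverts G" for x
      using fun_cong[OF cd(3), of x] that inj by simp
    then show "c = d" using cd(1,2) by (auto simp: colorings_at_def corr_colorings_def intro: PiE_ext)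
  qed
  show "?F ` colorings_at G m (permute_corr \<sigma> R) u v a b \<subseteq> colorings_at G m R u v (\<sigma> a) (\<sigma> b)"
    using uv by (auto simp: colorings_at_def corr_colorings_def permute_corr_def lt PiE_iff)
  show "finite (colorings_at G m R u v (\<sigma> a) (\<sigma> b))"
    using finite_corr_colorings[OF pg] by (simp add: colorings_at_def)
qed

section \<open>Averaging over permutations of the colors\<close>

text \<open>The color pairs open to the ends of an edge whose matching is the identity.\<close>

definition off_diag :: "nat \<Rightarrow> (nat \<times> nat) set" where
  "off_diag m = {(a, b). a < m \<and> b < m \<and> a \<noteq> b}"

lemma finite_off_diag: "finite (off_diag m)"
  by (rule finite_subset[of _ "{..<m} \<times> {..<m}"]) (auto simp: off_diag_def)

lemma card_off_diag: "card (off_diag m) = m * (m - 1)"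
proof -
  have "off_diag m = (SIGMA a:{..<m}. {..<m} - {a})" by (auto simp: off_diag_def)
  then have "card (off_diag m) = (\<Sum>a<m. card ({..<m} - {a}))" by simp
  also have "\<dots> = (\<Sum>a<m. m - 1)" by (intro sum.cong) auto
  finally show ?thesis by simp
qed

text \<open>The identity over \<open>uv\<close> forbids equal colors at \<open>u\<close> and
  \<open>v\<close>, so the off-diagonal pairs sort all colorings into disjoint classes.\<close>

lemma sum_card_colorings_at:
  assumes pg: "pair_graph G" and uv: "(u, v) \<in> parcs G"
    and id: "\<And>i. i < m \<Longrightarrow> ((u, i), (v, i)) \<in> R"
  shows "(\<Sum>(a, b)\<in>off_diag m. card (colorings_at G m R u v a b)) = card (corr_colorings G m R)"
proof -
  let ?A = "\<lambda>p. colorings_at G m R u v (fst p) (snd p)"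
  have V: "u \<in> pverts G" "v \<in> pverts G" using pg uv by (auto simp: pair_graph_iff)
  have fin: "finite (corr_colorings G m R)" by (rule finite_corr_colorings[OF pg])
  have "card (\<Union>p\<in>off_diag m. ?A p) = (\<Sum>p\<in>off_diag m. card (?A p))"
    by (rule card_UN_disjoint) (auto simp: finite_off_diag fin colorings_at_def)
  moreover have "(\<Union>p\<in>off_diag m. ?A p) = corr_colorings G m R"
  proof -
    have "(c u, c v) \<in> off_diag m" if c: "c \<in> corr_colorings G m R" for c
    proof -
      have lt: "c u < m" "c v < m" and nR: "((u, c u), (v, c v)) \<notin> R"
        using c V by (auto simp: corr_colorings_def)
      have "c u \<noteq> c v" using nR id[OF lt(1)] by auto
      then show ?thesis using lt by (simp add: off_diag_def)
    qed
    then show ?thesis by (fastforce simp: colorings_at_def)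
  qed
  ultimately show ?thesis by (simp add: case_prod_beta)
qed

text \<open>The symmetric group is 2-transitive: some \<open>\<tau>\<close> takes
  \<open>(a, b)\<close> to \<open>(c, d)\<close>, and composing with it reindexes the sum.\<close>

lemma sum_permutes_pair:
  fixes f :: "nat \<Rightarrow> nat \<Rightarrow> real"
  assumes "(a, b) \<in> off_diag m" "(c, d) \<in> off_diag m"
  shows "(\<Sum>\<sigma> | \<sigma> permutes {..<m}. f (\<sigma> a) (\<sigma> b)) = (\<Sum>\<sigma> | \<sigma> permutes {..<m}. f (\<sigma> c) (\<sigma> d))"
proof -
  have lt: "a < m" "b < m" "c < m" "d < m" and ne: "a \<noteq> b" "c \<noteq> d"
    using assms by (auto simp: off_diag_def)
  \<comment> \<open>The first swap takes \<open>a\<close> to \<open>c\<close> and \<open>b\<close>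
    to \<open>b'\<close>; the second takes \<open>b'\<close> to \<open>d\<close> and fixes
    \<open>c\<close>, which is neither \<open>b'\<close> nor \<open>d\<close>.\<close>
  define b' where "b' = transpose a c b"
  define \<tau> where "\<tau> = transpose b' d \<circ> transpose a c"
  have b': "b' < m" "b' \<noteq> c" using lt ne by (auto simp: b'_def transpose_def)
  have \<tau>: "\<tau> permutes {..<m}"
    unfolding \<tau>_def using lt b' by (intro permutes_compose permutes_swap_id) auto
  have val: "\<tau> a = c" "\<tau> b = d"
    using b' ne by (auto simp: \<tau>_def b'_def[symmetric])
  have "(\<Sum>\<sigma> | \<sigma> permutes {..<m}. f (\<sigma> c) (\<sigma> d)) = (\<Sum>\<sigma> | \<sigma> permutes {..<m}. f ((\<sigma> \<circ> \<tau>) a) ((\<sigma> \<circ> \<tau>) b))"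
    by (simp add: val)
  also have "\<dots> = (\<Sum>\<sigma> | \<sigma> permutes {..<m}. f (\<sigma> a) (\<sigma> b))"
    by (rule sum_permutations_compose_right[OF \<tau>, symmetric])
  finally show ?thesis ..
qed

text \<open>Double counting over pairs and permutations: the sum over permutations is the same for
  every pair, which gives the left side, and each permutation merely rearranges the pairs, which
  gives the right side.\<close>

lemma sum_permutes_average:
  fixes f :: "nat \<Rightarrow> nat \<Rightarrow> real"
  assumes ab: "(a, b) \<in> off_diag m"
  shows "(real m * (real m - 1)) * (\<Sum>\<sigma> | \<sigma> permutes {..<m}. f (\<sigma> a) (\<sigma> b))
    = fact m * (\<Sum>(c, d)\<in>off_diag m. f c d)"
proof -
  let ?P = "{\<sigma>. \<sigma> permutes {..<m}}"
  have m: "m \<ge> 1" using ab by (auto simp: off_diag_def)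
  have "(\<Sum>(c, d)\<in>off_diag m. \<Sum>\<sigma>\<in>?P. f (\<sigma> c) (\<sigma> d))
      = (\<Sum>p\<in>off_diag m. \<Sum>\<sigma>\<in>?P. f (\<sigma> a) (\<sigma> b))"
    by (rule sum.cong) (use sum_permutes_pair[OF ab] in auto)
  also have "\<dots> = (real m * (real m - 1)) * (\<Sum>\<sigma>\<in>?P. f (\<sigma> a) (\<sigma> b))"
    using m by (simp add: card_off_diag of_nat_diff)
  finally have "(real m * (real m - 1)) * (\<Sum>\<sigma>\<in>?P. f (\<sigma> a) (\<sigma> b))
      = (\<Sum>(c, d)\<in>off_diag m. \<Sum>\<sigma>\<in>?P. f (\<sigma> c) (\<sigma> d))" ..
  also have "\<dots> = (\<Sum>\<sigma>\<in>?P. \<Sum>(c, d)\<in>off_diag m. f (\<sigma> c) (\<sigma> d))"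
    by (subst sum.swap) (simp add: case_prod_beta)
  also have "\<dots> = (\<Sum>\<sigma>\<in>?P. \<Sum>(c, d)\<in>off_diag m. f c d)"
  proof (rule sum.cong[OF refl])
    fix \<sigma> assume "\<sigma> \<in> ?P"
    then have \<sigma>: "\<sigma> permutes {..<m}" by simp
    have lt: "\<sigma> i < m \<longleftrightarrow> i < m" for i using permutes_in_image[OF \<sigma>, of i] by simp
    have inj: "\<sigma> i = \<sigma> j \<longleftrightarrow> i = j" for i j
      using permutes_inj[OF \<sigma>] by (auto dest: injD)
    have "inj_on (map_prod \<sigma> \<sigma>) (off_diag m)" by (auto simp: inj_on_def inj)
    moreover have "map_prod \<sigma> \<sigma> ` off_diag m \<subseteq> off_diag m" by (auto simp: off_diag_def lt inj)
    ultimately have "bij_betw (map_prod \<sigma> \<sigma>) (off_diag m) (off_diag m)"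
      using finite_off_diag by (simp add: bij_betw_def endo_inj_surj)
    then have "(\<Sum>p\<in>off_diag m. (\<lambda>(c, d). f c d) (map_prod \<sigma> \<sigma> p)) = (\<Sum>(c, d)\<in>off_diag m. f c d)"
      by (rule sum.reindex_bij_betw)
    then show "(\<Sum>(c, d)\<in>off_diag m. f (\<sigma> c) (\<sigma> d)) = (\<Sum>(c, d)\<in>off_diag m. f c d)"
      by (simp add: case_prod_beta)
  qed
  also have "\<dots> = fact m * (\<Sum>(c, d)\<in>off_diag m. f c d)"
    by (simp add: card_permutations[OF refl])
  finally show ?thesis .
qed

section \<open>Gluing correspondences along the common edge\<close>

definition glue_corr ::
  "'i set \<Rightarrow> ('a \<Rightarrow> 'b) \<Rightarrow> ('i \<Rightarrow> ('a \<times> nat) rel) \<Rightarrow> ('b \<times> nat) rel" where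
  "glue_corr I q R = {((q x, a), (q y, b)) | x y a b. \<exists>i\<in>I. ((x, a), (y, b)) \<in> R i}"

text \<open>Matchings from different graphs lie over a common edge only at the identified one, and
  there each is the identity; hence their union is still a matching.\<close>

lemma glue_correspondence:
  fixes q :: "'a \<Rightarrow> 'b"
  assumes K: "pverts K = (\<Union>i\<in>I. q ` pverts (G i))" "parcs K = (\<Union>i\<in>I. map_prod q q ` parcs (G i))"
    and pg: "\<And>i. i \<in> I \<Longrightarrow> pair_graph (G i)"
    and uv: "\<And>i. i \<in> I \<Longrightarrow> (u i, v i) \<in> parcs (G i)"
    and R: "\<And>i. i \<in> I \<Longrightarrow> correspondence (G i) m (R i)"
    and id: "\<And>i a. i \<in> I \<Longrightarrow> a < m \<Longrightarrow> ((u i, a), (v i, a)) \<in> R i"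
    and q: "\<And>i j x y. i \<in> I \<Longrightarrow> j \<in> I \<Longrightarrow> x \<in> pverts (G i) \<Longrightarrow> y \<in> pverts (G j) \<Longrightarrow> q x = q y \<Longrightarrow>
      i = j \<and> x = y \<or> x = u i \<and> y = u j \<or> x = v i \<and> y = v j"
  shows "correspondence K m (glue_corr I q R)"
proof -
  have sy: "sym (R i)" if "i \<in> I" for i using R[OF that] by (simp add: correspondence_def)
  have Rsub: "(x, y) \<in> parcs (G i) \<and> a < m \<and> b < m" if "i \<in> I" "((x, a), (y, b)) \<in> R i" for i x y a b
    using R[OF that(1)] that(2) by (auto simp: correspondence_def)
  have mat: "b = c" if "i \<in> I" "((x, a), (y, b)) \<in> R i" "((x, a), (y, c)) \<in> R i" for i x y a b c
    using R[OF that(1)] that(2,3) by (auto simp: correspondence_def)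
  have V: "x \<in> pverts (G i)" "y \<in> pverts (G i)" "x \<noteq> y" if "i \<in> I" "(x, y) \<in> parcs (G i)" for i x y
    using pg[OF that(1)] that(2) by (auto simp: pair_graph_iff)
  \<comment> \<open>A matching that contains the whole identity equals it.\<close>
  have id': "b = a" if "i \<in> I" "((x, a), (y, b)) \<in> R i" "(x, y) = (u i, v i) \<or> (x, y) = (v i, u i)"
    for i x y a b
  proof -
    have "((u i, a), (v i, a)) \<in> R i" using id that Rsub[OF that(1,2)] by blast
    then have "((x, a), (y, a)) \<in> R i" using that(3) sy[OF that(1)] by (auto dest: symD)
    then show ?thesis using mat[OF that(1)] that(2) by blast
  qed
  show ?thesis
    unfolding correspondence_def
  proof (intro conjI allI impI)
    show "sym (glue_corr I q R)"
      unfolding sym_def glue_corr_def using sy by (fastforce dest: symD)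
  next
    fix X Y a b assume "((X, a), (Y, b)) \<in> glue_corr I q R"
    then obtain x y i where "X = q x" "Y = q y" "i \<in> I" "((x, a), (y, b)) \<in> R i"
      by (auto simp: glue_corr_def)
    then show "(X, Y) \<in> parcs K" "a < m" "b < m"
      unfolding K(2) using Rsub[of i x a y b] by force+
  next
    fix X Y a b c
    assume "((X, a), (Y, b)) \<in> glue_corr I q R" "((X, a), (Y, c)) \<in> glue_corr I q R"
    then obtain x y i x' y' j where
      1: "X = q x" "Y = q y" "i \<in> I" "((x, a), (y, b)) \<in> R i" and
      2: "X = q x'" "Y = q y'" "j \<in> I" "((x', a), (y', c)) \<in> R j"
      unfolding glue_corr_def by blast
    have e: "(x, y) \<in> parcs (G i)" "(x', y') \<in> parcs (G j)"
      using Rsub[OF 1(3,4)] Rsub[OF 2(3,4)] by auto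
    note V1 = V[OF 1(3) e(1)] and V2 = V[OF 2(3) e(2)]
    have qx: "i = j \<and> x = x' \<or> x = u i \<and> x' = u j \<or> x = v i \<and> x' = v j"
      using q[OF 1(3) 2(3) V1(1) V2(1)] 1 2 by simp
    have qy: "i = j \<and> y = y' \<or> y = u i \<and> y' = u j \<or> y = v i \<and> y' = v j"
      using q[OF 1(3) 2(3) V1(2) V2(2)] 1 2 by simp
    show "b = c"
    proof (cases "i = j")
      case True
      then have "x = x'" "y = y'" using qx qy by auto
      then show ?thesis using mat[OF 1(3,4)] 2(4) True by simp
    next
      case False
      \<comment> \<open>With \<open>i \<noteq> j\<close>, each end of the arc is an identified
        vertex; since the ends differ, one comes from \<open>u\<close> and the other from
        \<open>v\<close>.\<close>
      then have "(x, y) = (u i, v i) \<and> (x', y') = (u j, v j) \<or>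
          (x, y) = (v i, u i) \<and> (x', y') = (v j, u j)"
        using qx qy V1(3) V2(3) by auto
      then have "b = a" "c = a" using id'[OF 1(3,4)] id'[OF 2(3,4)] by auto
      then show ?thesis by simp
    qed
  qed
qed

text \<open>A coloring of the glued cover restricts to colorings of all pieces that share the colors
  at \<open>U\<close> and \<open>W\<close>. The \<open>q\<close>-images of the pieces cover
  \<open>K\<close>, so the restrictions determine the coloring.\<close>

lemma card_glue_colorings_le:
  fixes q :: "'a \<Rightarrow> 'b"
  assumes I: "finite I" "I \<noteq> {}"
    and K: "pverts K = (\<Union>i\<in>I. q ` pverts (G i))" "parcs K = (\<Union>i\<in>I. map_prod q q ` parcs (G i))"
    and pg: "\<And>i. i \<in> I \<Longrightarrow> pair_graph (G i)"
    and uv: "\<And>i. i \<in> I \<Longrightarrow> (u i, v i) \<in> parcs (G i)"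
    and id: "\<And>i a. i \<in> I \<Longrightarrow> a < m \<Longrightarrow> ((u i, a), (v i, a)) \<in> R i"
    and qu: "\<And>i. i \<in> I \<Longrightarrow> q (u i) = U" "\<And>i. i \<in> I \<Longrightarrow> q (v i) = W"
  shows "card (corr_colorings K m (glue_corr I q R))
    \<le> (\<Sum>(a, b)\<in>off_diag m. \<Prod>i\<in>I. card (colorings_at (G i) m (R i) (u i) (v i) a b))"
proof -
  let ?A = "\<lambda>p i. colorings_at (G i) m (R i) (u i) (v i) (fst p) (snd p)"
  let ?T = "SIGMA p:off_diag m. Pi\<^sub>E I (?A p)"
  let ?F = "\<lambda>c. ((c U, c W), \<lambda>i\<in>I. \<lambda>x\<in>pverts (G i). c (q x))"
  have V: "u i \<in> pverts (G i)" "v i \<in> pverts (G i)" if "i \<in> I" for i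
    using pg[OF that] uv[OF that] by (auto simp: pair_graph_iff)
  have finA: "finite (?A p i)" if "i \<in> I" for p i
    using finite_corr_colorings[OF pg[OF that]] by (simp add: colorings_at_def)
  have finPi: "finite (Pi\<^sub>E I (?A p))" for p using I(1) finA by (rule finite_PiE)
  have "card (corr_colorings K m (glue_corr I q R)) \<le> card ?T"
  proof (rule card_inj_on_le)
    show "inj_on ?F (corr_colorings K m (glue_corr I q R))"
    proof (rule inj_onI)
      fix c d assume cd: "c \<in> corr_colorings K m (glue_corr I q R)"
        "d \<in> corr_colorings K m (glue_corr I q R)" "?F c = ?F d"
      have "c X = d X" if X: "X \<in> pverts K" for X
      proof -
        obtain i x where ix: "i \<in> I" "x \<in> pverts (G i)" "X = q x" using X K(1) by auto
        have "snd (?F c) i x = snd (?F d) i x" using cd(3) by simp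
        then show ?thesis using ix by simp
      qed
      then show "c = d" using cd(1,2) by (auto simp: corr_colorings_def intro: PiE_ext)
    qed
    show "?F ` corr_colorings K m (glue_corr I q R) \<subseteq> ?T"
    proof (rule image_subsetI)
      fix c assume c: "c \<in> corr_colorings K m (glue_corr I q R)"
      have lt: "c (q x) < m" if "i \<in> I" "x \<in> pverts (G i)" for i x
        using c that K(1) by (auto simp: corr_colorings_def)
      have nR: "((x, c (q x)), (y, c (q y))) \<notin> R i"
        if "i \<in> I" "x \<in> pverts (G i)" "y \<in> pverts (G i)" for i x y
      proof
        assume "((x, c (q x)), (y, c (q y))) \<in> R i"
        then have "((q x, c (q x)), (q y, c (q y))) \<in> glue_corr I q R"
          using that by (auto simp: glue_corr_def)
        moreover have "q x \<in> pverts K" "q y \<in> pverts K" using that K(1) by auto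
        ultimately show False using c by (auto simp: corr_colorings_def)
      qed
      \<comment> \<open>One piece is enough to see that the colors at \<open>U\<close> and
        \<open>W\<close> differ; this is where \<open>I\<close> is nonempty.\<close>
      obtain i where i: "i \<in> I" using I(2) by blast
      have "c U \<noteq> c W"
        using nR[OF i V[OF i]] id[OF i lt[OF i V(1)[OF i]]] qu[OF i] by auto
      moreover have "c U < m" "c W < m" using lt[OF i] V[OF i] qu[OF i] by metis+
      ultimately have "(c U, c W) \<in> off_diag m" by (simp add: off_diag_def)
      moreover have "(\<lambda>x\<in>pverts (G i). c (q x)) \<in> ?A (c U, c W) i" if "i \<in> I" for i
        using nR[OF that] lt[OF that] V[OF that] qu[OF that]
        by (auto simp: colorings_at_def corr_colorings_def)
      ultimately show "?F c \<in> ?T" by auto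
    qed
    show "finite ?T" using finite_off_diag finPi by (rule finite_SigmaI)
  qed
  also have "card ?T = (\<Sum>p\<in>off_diag m. \<Prod>i\<in>I. card (?A p i))"
    using finite_off_diag finPi I(1) by (simp add: card_PiE)
  finally show ?thesis by (simp add: case_prod_beta)
qed

section \<open>Expected number of colorings of the randomly glued cover\<close>

theorem theorem4:
  fixes n m :: nat
    and G :: "nat \<Rightarrow> 'a pair_pre_digraph"
    and u v :: "nat \<Rightarrow> 'a"
  assumes "n \<ge> 2"
    and "\<And>i. i \<in> {1..n} \<Longrightarrow> pair_graph (G i)"
    and "disjoint_family_on (\<lambda>i. pverts (G i)) {1..n}"
    and "\<And>i. i \<in> {1..n} \<Longrightarrow> (u i, v i) \<in> parcs (G i)"
    and "m \<ge> 2"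
  shows "real (dp_color_function (edge_gluing {1..n} G u v) m)
    \<le> (\<Prod>i=1..n. real (dp_color_function (G i) m)) / (real m * (real m - 1)) ^ (n - 1)"
proof -
  let ?I = "{1..n}" and ?K = "edge_gluing {1..n} G u v" and ?P = "{\<sigma>. \<sigma> permutes {..<m}}"
  note pg = assms(2) and disj = assms(3) and uv = assms(4)
  have m: "m > 0" using assms(5) by simp
  define r where "r = identify_rel (pverts (graph_Union ?I G)) (u ` ?I) (v ` ?I)"
  define q where "q x = r `` {x}" for x
  have eq: "equiv (pverts (graph_Union ?I G)) r" and pgK: "pair_graph ?K"
    unfolding r_def using pair_graph_edge_gluing[OF _ pg disj uv] by auto
  have V: "u i \<in> pverts (G i)" "v i \<in> pverts (G i)" if "i \<in> ?I" for i
    using pg[OF that] uv[OF that] by (auto simp: pair_graph_iff)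
  have same: "i = j" if "x \<in> pverts (G i)" "x \<in> pverts (G j)" "i \<in> ?I" "j \<in> ?I" for i j x
    using disjoint_family_onD[OF disj that(3,4)] that(1,2) by blast
  have K: "pverts ?K = (\<Union>i\<in>?I. q ` pverts (G i))"
    "parcs ?K = (\<Union>i\<in>?I. map_prod q q ` parcs (G i))"
    unfolding edge_gluing_def r_def[symmetric] quotient_graph_def
    by (auto simp: q_def[abs_def] graph_Union_def quotient_def map_prod_def)
  have qD: "i = j \<and> x = y \<or> x = u i \<and> y = u j \<or> x = v i \<and> y = v j"
    if ij: "i \<in> ?I" "j \<in> ?I" and x: "x \<in> pverts (G i)" and y: "y \<in> pverts (G j)"
      and qxy: "q x = q y" for i j x y
  proof -
    have "y \<in> pverts (graph_Union ?I G)" using ij y by (auto simp: graph_Union_def)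
    then have "(x, y) \<in> r" using qxy eq_equiv_class[OF _ eq] by (simp add: q_def)
    then consider "x = y" | "x \<in> u ` ?I" "y \<in> u ` ?I" | "x \<in> v ` ?I" "y \<in> v ` ?I"
      by (auto simp: r_def identify_rel_def)
    then show ?thesis
    proof cases
      case 1 then show ?thesis using same x y ij by blast
    next
      case 2 then show ?thesis using same V x y ij by (metis imageE)
    next
      case 3 then show ?thesis using same V x y ij by (metis imageE)
    qed
  qed
  \<comment> \<open>Index 1 serves as representative of the identified vertices.\<close>
  have "(u i, u 1) \<in> r" "(v i, v 1) \<in> r" if "i \<in> ?I" for i
    using that assms(1) by (auto simp: r_def identify_rel_def)
  then have qu: "q (u i) = q (u 1)" "q (v i) = q (v 1)" if "i \<in> ?I" for i
    using that equiv_class_eq[OF eq] by (auto simp: q_def)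
  have "\<exists>R. correspondence (G i) m R \<and> (\<forall>a<m. ((u i, a), (v i, a)) \<in> R) \<and>
      card (corr_colorings (G i) m R) \<le> dp_color_function (G i) m" if "i \<in> ?I" for i
    using corr_straight_edge[OF pg[OF that] uv[OF that] m] by metis
  then obtain R where R: "\<And>i. i \<in> ?I \<Longrightarrow> correspondence (G i) m (R i)"
      "\<And>i a. i \<in> ?I \<Longrightarrow> a < m \<Longrightarrow> ((u i, a), (v i, a)) \<in> R i"
      "\<And>i. i \<in> ?I \<Longrightarrow> card (corr_colorings (G i) m (R i)) \<le> dp_color_function (G i) m"
    by metis
  define N where "N i a b = real (card (colorings_at (G i) m (R i) (u i) (v i) a b))" for i a b
  define P where "P i = real (card (corr_colorings (G i) m (R i)))" for i
  define X where "X = real (dp_color_function ?K m)"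
  define M where "M = real m * (real m - 1)"
  have M: "M > 0" using assms(5) by (simp add: M_def)
  have cardM: "real (card (off_diag m)) = M"
    using m by (simp add: M_def card_off_diag of_nat_diff)
  \<comment> \<open>Every tuple \<open>\<omega>\<close> of permutations yields a cover of the
    gluing, so \<open>X\<close> is at most the count for each \<open>\<omega>\<close> and therefore
    at most their average.\<close>
  have X: "X \<le> (\<Sum>(a, b)\<in>off_diag m. \<Prod>i\<in>?I. N i (\<omega> i a) (\<omega> i b))"
    if \<omega>: "\<omega> \<in> ?I \<rightarrow>\<^sub>E ?P" for \<omega>
  proof -
    define R' where "R' i = permute_corr (\<omega> i) (R i)" for i
    have perm: "\<omega> i permutes {..<m}" if "i \<in> ?I" for i using \<omega> that by auto
    have R': "correspondence (G i) m (R' i)" if "i \<in> ?I" for i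
      unfolding R'_def using R(1)[OF that] perm[OF that] by (rule correspondence_permute)
    have id': "((u i, a), (v i, a)) \<in> R' i" if "i \<in> ?I" "a < m" for i a
      using R(2)[OF that(1), of "\<omega> i a"] permutes_in_image[OF perm[OF that(1)], of a] that(2)
      by (simp add: R'_def permute_corr_def)
    have "correspondence ?K m (glue_corr ?I q R')"
      by (rule glue_correspondence[where u = u and v = v, OF K pg uv R' id' qD])
    then have "dp_color_function ?K m \<le> card (corr_colorings ?K m (glue_corr ?I q R'))"
      by (intro dp_color_function_le_corr pgK m)
    also have "\<dots> \<le> (\<Sum>(a, b)\<in>off_diag m. \<Prod>i\<in>?I. card (colorings_at (G i) m (R' i) (u i) (v i) a b))"
      using assms(1) by (intro card_glue_colorings_le[OF _ _ K pg uv id' qu]) auto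
    also have "\<dots> \<le> (\<Sum>(a, b)\<in>off_diag m. \<Prod>i\<in>?I.
        card (colorings_at (G i) m (R i) (u i) (v i) (\<omega> i a) (\<omega> i b)))"
      unfolding case_prod_beta R'_def
      by (intro sum_mono prod_mono conjI card_colorings_at_permute_le pg perm V) auto
    finally have "X \<le> real \<dots>" unfolding X_def by (rule of_nat_mono)
    then show ?thesis by (simp add: N_def case_prod_beta)
  qed
  \<comment> \<open>The mean of the \<open>i\<close>-th factor is \<open>P i / M\<close>, whatever
    the pair \<open>(a, b)\<close>.\<close>
  have S: "(\<Sum>\<sigma>\<in>?P. N i (\<sigma> a) (\<sigma> b)) = fact m * P i / M" if "(a, b) \<in> off_diag m" "i \<in> ?I" for i a b
  proof -
    have "(\<Sum>(c, d)\<in>off_diag m. N i c d) = P i"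
      using sum_card_colorings_at[OF pg[OF that(2)] uv[OF that(2)] R(2)[OF that(2)]]
      unfolding N_def P_def by (simp add: case_prod_beta flip: of_nat_sum)
    then have "M * (\<Sum>\<sigma>\<in>?P. N i (\<sigma> a) (\<sigma> b)) = fact m * P i"
      using sum_permutes_average[OF that(1), of "N i"] unfolding M_def[symmetric] by (simp only:)
    then show ?thesis using M by (simp add: eq_divide_eq mult.commute)
  qed
  have cardP: "card ?P = fact m" by (rule card_permutations) auto
  have finP: "finite ?P" by (rule finite_permutations) simp
  have "fact m ^ n * X = (\<Sum>\<omega>\<in>?I \<rightarrow>\<^sub>E ?P. X)"
    by (simp add: card_PiE cardP)
  also have "\<dots> \<le> (\<Sum>\<omega>\<in>?I \<rightarrow>\<^sub>E ?P. \<Sum>(a, b)\<in>off_diag m. \<Prod>i\<in>?I. N i (\<omega> i a) (\<omega> i b))"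
    by (intro sum_mono X)
  also have "\<dots> = (\<Sum>(a, b)\<in>off_diag m. \<Sum>\<omega>\<in>?I \<rightarrow>\<^sub>E ?P. \<Prod>i\<in>?I. N i (\<omega> i a) (\<omega> i b))"
    unfolding case_prod_beta by (rule sum.swap)
  \<comment> \<open>Independence of the permutations: a sum over tuples of a product of
    one-coordinate terms is the product of the sums.\<close>
  also have "\<dots> = (\<Sum>(a, b)\<in>off_diag m. \<Prod>i\<in>?I. \<Sum>\<sigma>\<in>?P. N i (\<sigma> a) (\<sigma> b))"
    by (subst prod_sum_PiE) (use finP in auto)
  also have "\<dots> = (\<Sum>p\<in>off_diag m. \<Prod>i\<in>?I. fact m * P i / M)"
    by (intro sum.cong refl) (auto simp: S intro!: prod.cong)
  also have "\<dots> = M * (fact m ^ n * (\<Prod>i\<in>?I. P i) / M ^ n)"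
    by (simp add: cardM prod_dividef prod.distrib)
  \<comment> \<open>The factor \<open>M\<close> that counts the color pairs cancels one of the
    \<open>n\<close> factors below, leaving exponent \<open>n - 1\<close>.\<close>
  also have "\<dots> = fact m ^ n * ((\<Prod>i\<in>?I. P i) / M ^ (n - 1))"
    using M assms(1) by (cases n) (auto simp: field_simps)
  finally have "X \<le> (\<Prod>i\<in>?I. P i) / M ^ (n - 1)"
    by (rule mult_left_le_imp_le) simp
  \<comment> \<open>Straightening the edge did not raise the number of colorings above the optimum
    for \<open>G i\<close>.\<close>
  also have "\<dots> \<le> (\<Prod>i\<in>?I. real (dp_color_function (G i) m)) / M ^ (n - 1)"
    using M R(3) by (intro divide_right_mono prod_mono) (auto simp: P_def)
  finally show ?thesis by (simp add: X_def M_def)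
qed

end
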